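(* Let $\eta=e^{\pi i/3}$ and consider the matrices with entries in $\mathbb{Z}/6\mathbb{Z}$ $$A=\begin{pmatrix}0&0&0&0&0&0\\0&0&2&2&4&4\\0&2&0&4&2&4\\0&2&4&0&4&2\\0&4&2&4&0&2\\0&4&4&2&2&0\end{pmatrix},\qquad B=\begin{pmatrix}0&0&0&0&0&0\\0&0&2&2&4&4\\0&0&4&4&2&2\\0&3&0&3&1&4\\0&3&2&5&5&2\\0&3&4&1&3&0\end{pmatrix}.$$ Let $H$ and $K$ be the $6\times6$ complex matrices with entries $H_{rs}=\eta^{A_{rs}}$ and $K_{rs}=\eta^{B_{rs}}$, with columns $h_0,\dots,h_5$ and $k_0,\dots,k_5$, respectively, and let $\Phi_{32}$ be the $6\times 6$ array of vectors with $(i,j)$ entry $\frac{1}{\sqrt6}(h_i\odot k_j)\in\mathbb{C}^6$, $0\le i,j\le5$. Then $\Phi_{32}$ is a quantum Latin square of order $6$ and its cardinality is $32$.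
   Context: For $x,y\in\mathbb{C}^n$, $x\odot y=(x_0y_0,\dots,x_{n-1}y_{n-1})^{\mathsf T}$ is the entrywise (Schur) product. A quantum Latin square of order $n$, denoted $\mathrm{QLS}(n)$, is an $n\times n$ array $(\phi_{ij})_{0\le i,j\le n-1}$ of unit vectors in $\mathbb{C}^n$ such that every row and every column forms an orthonormal basis of $\mathbb{C}^n$. Two unit vectors $u,v$ are phase equivalent, $u\sim v$, if $u=e^{i\alpha}v$ for some $\alpha\in\mathbb{R}$. The cardinality of a quantum Latin square is the number of distinct phase-equivalence classes among its $n^2$ entries. *)

theory Defs
  imports Complex_Main "Jordan_Normal_Form.VS_Connect"
begin

definition schur_prod :: "complex vec \<Rightarrow> complex vec \<Rightarrow> complex vec" (infixl "\<odot>\<^sub>v" 70) where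
  "x \<odot>\<^sub>v y = vec (dim_vec x) (\<lambda>i. x $ i * y $ i)"

definition unit_length :: "complex vec \<Rightarrow> bool" where
  "unit_length v \<longleftrightarrow> v \<bullet>c v = 1"

definition orthonormal_basis :: "nat \<Rightarrow> (nat \<Rightarrow> complex vec) \<Rightarrow> bool" where
  "orthonormal_basis n v \<longleftrightarrow>
     vectorspace.basis class_ring (module_vec TYPE(complex) n) (v ` {..<n}) \<and>
     (\<forall>i<n. \<forall>j<n. v i \<bullet>c v j = (if i = j then 1 else 0))"

text \<open>Only the entries \<open>\<phi> i j\<close> with \<open>i, j < n\<close> of an array are meaningful.\<close>

definition quantum_latin_square :: "nat \<Rightarrow> (nat \<Rightarrow> nat \<Rightarrow> complex vec) \<Rightarrow> bool" where
  "quantum_latin_square n \<phi> \<longleftrightarrow>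
     (\<forall>i<n. \<forall>j<n. \<phi> i j \<in> carrier_vec n \<and> unit_length (\<phi> i j)) \<and>
     (\<forall>i<n. orthonormal_basis n (\<lambda>j. \<phi> i j)) \<and>
     (\<forall>j<n. orthonormal_basis n (\<lambda>i. \<phi> i j))"

definition phase_equiv :: "complex vec \<Rightarrow> complex vec \<Rightarrow> bool" where
  "phase_equiv u v \<longleftrightarrow> (\<exists>\<alpha>::real. u = exp (\<i> * of_real \<alpha>) \<cdot>\<^sub>v v)"

definition qls_entries :: "nat \<Rightarrow> (nat \<Rightarrow> nat \<Rightarrow> complex vec) \<Rightarrow> complex vec set" where
  "qls_entries n \<phi> = {\<phi> i j | i j. i < n \<and> j < n}"

definition qls_cardinality :: "nat \<Rightarrow> (nat \<Rightarrow> nat \<Rightarrow> complex vec) \<Rightarrow> nat" where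
  "qls_cardinality n \<phi> =
     card (qls_entries n \<phi> //
       {(u, v). u \<in> qls_entries n \<phi> \<and> v \<in> qls_entries n \<phi> \<and> phase_equiv u v})"

definition \<eta> :: complex where
  "\<eta> = exp (\<i> * of_real pi / 3)"

text \<open>Residue classes modulo 6 are given by their representatives in \<open>{0..5}\<close>; since
  \<open>\<eta> ^ 6 = 1\<close>, the powers of \<open>\<eta>\<close> do not depend on this choice.\<close>

definition A_mat :: "nat mat" where
  "A_mat = mat_of_rows_list 6
    [[0, 0, 0, 0, 0, 0],
     [0, 0, 2, 2, 4, 4],
     [0, 2, 0, 4, 2, 4],
     [0, 2, 4, 0, 4, 2],
     [0, 4, 2, 4, 0, 2],
     [0, 4, 4, 2, 2, 0]]"

definition B_mat :: "nat mat" where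
  "B_mat = mat_of_rows_list 6
    [[0, 0, 0, 0, 0, 0],
     [0, 0, 2, 2, 4, 4],
     [0, 0, 4, 4, 2, 2],
     [0, 3, 0, 3, 1, 4],
     [0, 3, 2, 5, 5, 2],
     [0, 3, 4, 1, 3, 0]]"

definition H_mat :: "complex mat" where
  "H_mat = map_mat (\<lambda>a. \<eta> ^ a) A_mat"

definition K_mat :: "complex mat" where
  "K_mat = map_mat (\<lambda>b. \<eta> ^ b) B_mat"

definition \<Phi>\<^sub>3\<^sub>2 :: "nat \<Rightarrow> nat \<Rightarrow> complex vec" where
  "\<Phi>\<^sub>3\<^sub>2 i j = complex_of_real (1 / sqrt 6) \<cdot>\<^sub>v (col H_mat i \<odot>\<^sub>v col K_mat j)"

end

theory Submission
  imports Defs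
begin

text \<open>Since the entries of \<open>H\<close> and \<open>K\<close> have modulus \<open>1\<close>, the inner product of two entries in a
  common row (column) of \<open>\<Phi>\<^sub>3\<^sub>2\<close> is \<open>1/6\<close> times that of two columns of \<open>K\<close> (of \<open>H\<close>); so the
  quantum Latin square property says that \<open>H\<close> and \<open>K\<close> are Hadamard matrices. The first rows of
  \<open>A\<close> and \<open>B\<close> vanish, so all entries of \<open>\<Phi>\<^sub>3\<^sub>2\<close> have the same first coordinate, and phase
  equivalent entries are equal. The cardinality is therefore the number of distinct exponent
  vectors modulo \<open>6\<close>. Both facts are finite computations with exponents.\<close>

text \<open>Pairing a vanishing linear combination with \<open>v j\<close> isolates the coefficient
  of \<open>v j\<close>, so the family is independent; \<open>n\<close> independent vectors in
  dimension \<open>n\<close> form a basis. Thus only inner products remain to be computed.\<close>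

lemma orthonormal_imp_basis:
  fixes v :: "nat \<Rightarrow> complex vec"
  assumes carr: "\<And>i. i < n \<Longrightarrow> v i \<in> carrier_vec n"
    and orth: "\<And>i j. i < n \<Longrightarrow> j < n \<Longrightarrow> v i \<bullet>c v j = (if i = j then 1 else 0)"
  shows "orthonormal_basis n v"
proof -
  interpret vec_space "TYPE(complex)" n .
  \<comment> \<open>The basis is the image set, so distinctness of the \<open>v i\<close> is what
    lets sums over it be reindexed by \<open>i\<close> and gives it \<open>n\<close>
    elements.\<close>
  have inj: "inj_on v {..<n}"
  proof (rule inj_onI)
    fix i j assume "i \<in> {..<n}" "j \<in> {..<n}" "v i = v j"
    then show "i = j"
      using orth[of i i] orth[of i j] by (auto split: if_splits)
  qed
  have sub: "v ` {..<n} \<subseteq> carrier_vec n" using carr by auto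
  have "lin_indpt (v ` {..<n})"
  proof (rule finite_lin_indpt2)
    fix a assume zero: "lincomb a (v ` {..<n}) = 0\<^sub>v n"
    show "\<forall>x\<in>v ` {..<n}. a x = 0"
    proof
      fix x assume "x \<in> v ` {..<n}"
      then obtain j where j: "j < n" and x: "x = v j" by auto
      have "0 = lincomb a (v ` {..<n}) \<bullet>c v j"
        using zero carr[OF j] by simp
      also have "\<dots> = (\<Sum>k<n. (\<Sum>i<n. a (v i) * v i $ k) * cnj (v j $ k))"
        using carr[OF j] by (simp add: scalar_prod_def lincomb_index[OF _ sub]
          sum.reindex[OF inj] atLeast0LessThan)
      also have "\<dots> = (\<Sum>i<n. a (v i) * (\<Sum>k<n. v i $ k * cnj (v j $ k)))"
        unfolding sum_distrib_left sum_distrib_right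
        by (subst sum.swap) (simp add: mult.assoc)
      also have "\<dots> = (\<Sum>i<n. a (v i) * (v i \<bullet>c v j))"
        using carr[OF j] by (simp add: scalar_prod_def atLeast0LessThan)
      also have "\<dots> = (\<Sum>i<n. if i = j then a (v i) else 0)"
        by (rule sum.cong) (auto simp: orth j)
      also have "\<dots> = a (v j)" using j by simp
      finally show "a x = 0" by (simp add: x)
    qed
  qed (use sub in auto)
  then have "basis (v ` {..<n})"
    using sub inj by (intro dim_li_is_basis) (auto simp: card_image dim_is_n)
  then show ?thesis
    unfolding orthonormal_basis_def using orth by simp
qed

text \<open>Plain lists, in place of \<open>A_mat\<close> and \<open>B_mat\<close>, so that the
  finite checks can be evaluated; \<open>Phi_eq_eta_vec\<close> links the two forms.\<close>

definition A_rows :: "nat list list" where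
  "A_rows =
    [[0, 0, 0, 0, 0, 0],
     [0, 0, 2, 2, 4, 4],
     [0, 2, 0, 4, 2, 4],
     [0, 2, 4, 0, 4, 2],
     [0, 4, 2, 4, 0, 2],
     [0, 4, 4, 2, 2, 0]]"

definition B_rows :: "nat list list" where
  "B_rows =
    [[0, 0, 0, 0, 0, 0],
     [0, 0, 2, 2, 4, 4],
     [0, 0, 4, 4, 2, 2],
     [0, 3, 0, 3, 1, 4],
     [0, 3, 2, 5, 5, 2],
     [0, 3, 4, 1, 3, 0]]"

text \<open>Reduction modulo 6 makes the lists canonical, so that equality of vectors becomes
  equality of lists.\<close>

definition exponents :: "nat \<Rightarrow> nat \<Rightarrow> nat list" where
  "exponents i j = map (\<lambda>r. (A_rows ! r ! i + B_rows ! r ! j) mod 6) [0..<6]"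

definition eta_vec :: "nat list \<Rightarrow> complex vec" where
  "eta_vec e = vec 6 (\<lambda>r. complex_of_real (1 / sqrt 6) * \<eta> ^ (e ! r))"

lemma eta_cis: "\<eta> ^ k = cis (real k * pi / 3)"
  by (simp add: \<eta>_def cis_conv_exp flip: exp_of_nat_mult) (simp add: field_simps)

lemma eta_power_6: "\<eta> ^ 6 = 1"
  by (simp add: eta_cis)

lemma eta_power_mod: "\<eta> ^ (k mod 6) = \<eta> ^ k"
proof -
  have "\<eta> ^ k = \<eta> ^ (6 * (k div 6) + k mod 6)" by simp
  also have "\<dots> = \<eta> ^ (k mod 6)"
    by (simp only: power_add power_mult eta_power_6) simp
  finally show ?thesis by simp
qed

lemma Phi_eq_eta_vec:
  assumes "i < 6" "j < 6"
  shows "\<Phi>\<^sub>3\<^sub>2 i j = eta_vec (exponents i j)"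
proof (rule eq_vecI)
  show "dim_vec (\<Phi>\<^sub>3\<^sub>2 i j) = dim_vec (eta_vec (exponents i j))"
    by (simp add: \<Phi>\<^sub>3\<^sub>2_def schur_prod_def eta_vec_def H_mat_def A_mat_def mat_of_rows_list_def)
  fix r assume "r < dim_vec (eta_vec (exponents i j))"
  then have "r < 6" by (simp add: eta_vec_def)
  then show "\<Phi>\<^sub>3\<^sub>2 i j $ r = eta_vec (exponents i j) $ r"
    using assms by (simp add: \<Phi>\<^sub>3\<^sub>2_def schur_prod_def eta_vec_def exponents_def eta_power_mod
      power_add H_mat_def A_mat_def K_mat_def B_mat_def A_rows_def B_rows_def
      mat_of_rows_list_def)
qed

text \<open>The factor 5 stands for -1 modulo 6, that is, for conjugation, while exponents stay
  natural numbers. The common summand \<open>a\<close> contributes \<open>6 * a\<close>, which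
  disappears: a factor of modulus 1 cancels against its conjugate.\<close>

lemma eta_power_cancel: "\<eta> ^ ((a + b) mod 6 + 5 * ((a + c) mod 6)) = \<eta> ^ (b + 5 * c)"
proof -
  have "((a + b) mod 6 + 5 * ((a + c) mod 6)) mod 6 = ((a + b) + 5 * (a + c)) mod 6"
    by (intro mod_add_cong mod_mult_cong) simp_all
  also have "\<dots> = (6 * a + (b + 5 * c)) mod 6"
    by (rule arg_cong[of _ _ "\<lambda>x. x mod 6"]) simp
  also have "\<dots> = (b + 5 * c) mod 6" by simp
  finally show ?thesis by (metis eta_power_mod)
qed

text \<open>Both sides are inverse to \<open>\<eta> ^ k\<close>, one because the modulus is 1, the
  other because \<open>\<eta> ^ 6 = 1\<close>.\<close>

lemma eta_cnj: "cnj (\<eta> ^ k) = \<eta> ^ (5 * k)"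
proof -
  have "\<eta> ^ k * \<eta> ^ (5 * k) = (\<eta> ^ 6) ^ k"
    by (simp flip: power_add power_mult)
  then have "\<eta> ^ k * \<eta> ^ (5 * k) = 1" by (simp add: eta_power_6)
  moreover have "\<eta> ^ k * cnj (\<eta> ^ k) = 1"
    by (simp add: eta_cis cis_cnj cis_mult)
  ultimately show ?thesis
    by (metis mult.commute mult.assoc mult_1)
qed

text \<open>Coordinates of \<open>\<eta> ^ k\<close> in the basis \<open>1, \<eta>\<close> of \<open>\<int>[\<eta>]\<close>, where \<open>\<eta>\<^sup>2 = \<eta> - 1\<close>.\<close>

definition eis :: "nat \<Rightarrow> int \<times> int" where
  "eis k = [(1, 0), (0, 1), (-1, 1), (-1, 0), (0, -1), (1, -1)] ! (k mod 6)"

lemma eta_square: "\<eta>\<^sup>2 = \<eta> - 1"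
  using eta_cis[of 1] eta_cis[of 2]
  by (simp add: complex_eq_iff cos_60 sin_60 cos_120 sin_120)

lemma eta_power_eis: "\<eta> ^ k = of_int (fst (eis k)) + of_int (snd (eis k)) * \<eta>"
proof -
  have *: "\<eta> ^ 3 = -1" "\<eta> ^ 4 = -\<eta>" "\<eta> ^ 5 = 1 - \<eta>"
  proof -
    have s: "\<eta> * \<eta> = \<eta> - 1" using eta_square by (simp add: power2_eq_square)
    show 3: "\<eta> ^ 3 = -1" by (simp add: power3_eq_cube s algebra_simps)
    have "\<eta> ^ 4 = \<eta> ^ 3 * \<eta>" "\<eta> ^ 5 = \<eta> ^ 3 * \<eta>\<^sup>2" by (simp_all flip: power_Suc2 power_add)
    then show "\<eta> ^ 4 = -\<eta>" "\<eta> ^ 5 = 1 - \<eta>" by (simp_all add: 3 eta_square)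
  qed
  have "k mod 6 \<in> {0, 1, 2, 3, 4, 5}" by auto
  then have "\<eta> ^ (k mod 6) = of_int (fst (eis k)) + of_int (snd (eis k)) * \<eta>"
    by (auto simp: eis_def eta_square *)
  then show ?thesis by (simp add: eta_power_mod)
qed

lemma eta_vec_cscalar_prod:
  "eta_vec e \<bullet>c eta_vec f = (\<Sum>r<6. \<eta> ^ (e ! r + 5 * (f ! r))) / 6"
proof -
  have "complex_of_real (1 / sqrt 6) * complex_of_real (1 / sqrt 6) = 1 / 6"
    by (simp only: flip: of_real_mult) simp
  then have "complex_of_real (1 / sqrt 6) * \<eta> ^ k *
      cnj (complex_of_real (1 / sqrt 6) * \<eta> ^ l) = \<eta> ^ (k + 5 * l) / 6" for k l
    unfolding complex_cnj_mult complex_cnj_complex_of_real eta_cnj power_add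
    by (simp only: mult_ac) (simp add: mult_ac)
  moreover have "eta_vec e \<bullet>c eta_vec f = (\<Sum>r<6. complex_of_real (1 / sqrt 6) * \<eta> ^ (e ! r) *
      cnj (complex_of_real (1 / sqrt 6) * \<eta> ^ (f ! r)))"
    by (simp add: scalar_prod_def eta_vec_def atLeast0LessThan)
  ultimately show ?thesis
    by (simp only: sum_divide_distrib)
qed

lemma Phi_cscalar_prod_row:
  assumes "i < 6" "j < 6" "k < 6"
  shows "\<Phi>\<^sub>3\<^sub>2 i j \<bullet>c \<Phi>\<^sub>3\<^sub>2 i k =
    (\<Sum>r<6. \<eta> ^ (B_rows ! r ! j + 5 * B_rows ! r ! k)) / 6"
  using assms by (simp add: Phi_eq_eta_vec eta_vec_cscalar_prod exponents_def eta_power_cancel)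

lemma Phi_cscalar_prod_column:
  assumes "i < 6" "j < 6" "k < 6"
  shows "\<Phi>\<^sub>3\<^sub>2 i k \<bullet>c \<Phi>\<^sub>3\<^sub>2 j k =
    (\<Sum>r<6. \<eta> ^ (A_rows ! r ! i + 5 * A_rows ! r ! j)) / 6"
  \<comment> \<open>In a column the shared exponent is the one from \<open>B_rows\<close>, the right
    summand, so it is commuted to the left before cancelling.\<close>
  using assms eta_power_cancel[of "B_rows ! r ! k" for r]
  by (simp add: Phi_eq_eta_vec eta_vec_cscalar_prod exponents_def add.commute)

text \<open>Inner product of two columns in the coordinates of \<open>eis\<close>: integer
  arithmetic that can be evaluated.\<close>

definition eis_gram :: "nat list list \<Rightarrow> nat \<Rightarrow> nat \<Rightarrow> int \<times> int" where
  "eis_gram M i j =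
    (let zs = map (\<lambda>r. eis (M ! r ! i + 5 * M ! r ! j)) [0..<6]
     in (sum_list (map fst zs), sum_list (map snd zs)))"

lemma sum_eta_power_eis_gram:
  "(\<Sum>r<6. \<eta> ^ (M ! r ! i + 5 * M ! r ! j)) =
     of_int (fst (eis_gram M i j)) + of_int (snd (eis_gram M i j)) * \<eta>"
  by (subst eta_power_eis)
    (simp add: sum.distrib sum_distrib_right eis_gram_def comp_def
      interv_sum_list_conv_sum_set_nat atLeast0LessThan)

text \<open>This is the Hadamard property of both matrices, checked by evaluation.\<close>

lemma eis_gram_rows:
  "\<forall>M\<in>set [A_rows, B_rows]. \<forall>i\<in>set [0..<6]. \<forall>j\<in>set [0..<6].
     eis_gram M i j = (if i = j then 6 else 0, 0)"
  by code_simp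

lemma sum_eta_power_rows:
  assumes "M \<in> {A_rows, B_rows}" "i < 6" "j < 6"
  shows "(\<Sum>r<6. \<eta> ^ (M ! r ! i + 5 * M ! r ! j)) = (if i = j then 6 else 0)"
  using eis_gram_rows assms by (auto simp: sum_eta_power_eis_gram)

text \<open>The source of the number 32: evaluating all 36 index pairs leaves 32 distinct
  lists.\<close>

lemma card_exponents:
  "card ((\<lambda>(i, j). exponents i j) ` set (List.product [0..<6] [0..<6])) = 32"
  by code_simp

lemma eta_power_inj:
  assumes "\<eta> ^ k = \<eta> ^ l" "k < 6" "l < 6"
  shows "k = l"
proof -
  have "cis (real k * pi / 3) = cis (real l * pi / 3)" using assms by (simp add: eta_cis)
  \<comment> \<open>The angle is rewritten to the form in \<open>bij_betw_roots_unity\<close>, which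
    lists the sixth roots of unity without repetition.\<close>
  then have "cis (2 * pi * real k / real 6) = cis (2 * pi * real l / real 6)"
    by (simp add: mult_ac)
  with bij_betw_roots_unity[of 6] show ?thesis
    using assms by (auto simp: bij_betw_def inj_on_def)
qed

lemma inj_on_eta_vec: "inj_on eta_vec {e. length e = 6 \<and> set e \<subseteq> {..<6}}"
proof (rule inj_onI)
  fix e f assume ef: "e \<in> {e. length e = 6 \<and> set e \<subseteq> {..<6}}"
    "f \<in> {e. length e = 6 \<and> set e \<subseteq> {..<6}}" and eq: "eta_vec e = eta_vec f"
  show "e = f"
  proof (rule nth_equalityI)
    fix r assume "r < length e"
    then have r: "r < 6" using ef by simp
    have "eta_vec e $ r = eta_vec f $ r" using eq by simp
    then have "\<eta> ^ (e ! r) = \<eta> ^ (f ! r)" using r by (simp add: eta_vec_def)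
    moreover have "e ! r < 6" "f ! r < 6"
      using ef r nth_mem[of r e] nth_mem[of r f] by (auto simp: subset_iff)
    ultimately show "e ! r = f ! r" by (rule eta_power_inj)
  qed (use ef in auto)
qed

lemma phase_equiv_Phi_iff:
  assumes "i < 6" "j < 6" "k < 6" "l < 6"
  shows "phase_equiv (\<Phi>\<^sub>3\<^sub>2 i j) (\<Phi>\<^sub>3\<^sub>2 k l) \<longleftrightarrow> \<Phi>\<^sub>3\<^sub>2 i j = \<Phi>\<^sub>3\<^sub>2 k l"
proof
  \<comment> \<open>The shared first coordinate is nonzero, so comparing it on both sides forces the
    phase factor to be 1.\<close>
  have first: "\<Phi>\<^sub>3\<^sub>2 a b $ 0 = complex_of_real (1 / sqrt 6)" "dim_vec (\<Phi>\<^sub>3\<^sub>2 a b) = 6"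
    if "a < 6" "b < 6" for a b
  proof -
    have "a \<in> {0, 1, 2, 3, 4, 5}" "b \<in> {0, 1, 2, 3, 4, 5}" using that by auto
    then have "exponents a b ! 0 = 0"
      by (auto simp: exponents_def A_rows_def B_rows_def)
    then show "\<Phi>\<^sub>3\<^sub>2 a b $ 0 = complex_of_real (1 / sqrt 6)" "dim_vec (\<Phi>\<^sub>3\<^sub>2 a b) = 6"
      using that by (simp_all add: Phi_eq_eta_vec eta_vec_def)
  qed
  assume "phase_equiv (\<Phi>\<^sub>3\<^sub>2 i j) (\<Phi>\<^sub>3\<^sub>2 k l)"
  then obtain \<alpha> :: real where
    \<alpha>: "\<Phi>\<^sub>3\<^sub>2 i j = exp (\<i> * of_real \<alpha>) \<cdot>\<^sub>v \<Phi>\<^sub>3\<^sub>2 k l"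
    unfolding phase_equiv_def by blast
  then have "\<Phi>\<^sub>3\<^sub>2 i j $ 0 = exp (\<i> * of_real \<alpha>) * \<Phi>\<^sub>3\<^sub>2 k l $ 0"
    using assms by (simp add: first)
  then have "exp (\<i> * of_real \<alpha>) = 1"
    using assms by (simp add: first)
  with \<alpha> show "\<Phi>\<^sub>3\<^sub>2 i j = \<Phi>\<^sub>3\<^sub>2 k l" by simp
next
  assume "\<Phi>\<^sub>3\<^sub>2 i j = \<Phi>\<^sub>3\<^sub>2 k l"
  then show "phase_equiv (\<Phi>\<^sub>3\<^sub>2 i j) (\<Phi>\<^sub>3\<^sub>2 k l)"
    unfolding phase_equiv_def by (intro exI[of _ 0]) simp
qed

text \<open>All classes are singletons. Once phase equivalence is known to be equality, this turns
  the count of classes into a count of entries.\<close>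

lemma card_quotient_identity: "card (S // {(u, v). u \<in> S \<and> v \<in> S \<and> u = v}) = card S"
proof -
  have "S // {(u, v). u \<in> S \<and> v \<in> S \<and> u = v} = (\<lambda>x. {x}) ` S"
    by (auto simp: quotient_def)
  then show ?thesis by (simp add: card_image)
qed

theorem theorem6:
  shows "quantum_latin_square 6 \<Phi>\<^sub>3\<^sub>2 \<and> qls_cardinality 6 \<Phi>\<^sub>3\<^sub>2 = 32"
proof
  have carr: "\<Phi>\<^sub>3\<^sub>2 i j \<in> carrier_vec 6" if "i < 6" "j < 6" for i j
    using that by (simp add: Phi_eq_eta_vec eta_vec_def)
  have rows: "\<Phi>\<^sub>3\<^sub>2 i j \<bullet>c \<Phi>\<^sub>3\<^sub>2 i k = (if j = k then 1 else 0)"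
    if "i < 6" "j < 6" "k < 6" for i j k
    using that by (simp add: Phi_cscalar_prod_row sum_eta_power_rows)
  have columns: "\<Phi>\<^sub>3\<^sub>2 i k \<bullet>c \<Phi>\<^sub>3\<^sub>2 j k = (if i = j then 1 else 0)"
    if "i < 6" "j < 6" "k < 6" for i j k
    using that by (simp add: Phi_cscalar_prod_column sum_eta_power_rows)
  show "quantum_latin_square 6 \<Phi>\<^sub>3\<^sub>2"
    unfolding quantum_latin_square_def unit_length_def
    using carr rows columns by (auto intro!: orthonormal_imp_basis)
  let ?E = "(\<lambda>(i, j). exponents i j) ` set (List.product [0..<6] [0..<6])"
  have "qls_entries 6 \<Phi>\<^sub>3\<^sub>2 = (\<lambda>(i, j). \<Phi>\<^sub>3\<^sub>2 i j) ` set (List.product [0..<6] [0..<6])"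
    unfolding qls_entries_def by (auto simp: image_iff) blast
  also have "\<dots> = eta_vec ` ?E"
    unfolding image_comp by (rule image_cong) (auto simp: Phi_eq_eta_vec)
  finally have entries: "qls_entries 6 \<Phi>\<^sub>3\<^sub>2 = eta_vec ` ?E" .
  \<comment> \<open>On reduced lists \<open>eta_vec\<close> is injective, so the evaluated count of
    lists carries over to the entries.\<close>
  have "?E \<subseteq> {e. length e = 6 \<and> set e \<subseteq> {..<6}}"
    by (auto simp: exponents_def)
  then have card: "card (qls_entries 6 \<Phi>\<^sub>3\<^sub>2) = 32"
    unfolding entries
    using card_exponents inj_on_subset[OF inj_on_eta_vec] by (simp only: card_image)
  have "{(u, v). u \<in> qls_entries 6 \<Phi>\<^sub>3\<^sub>2 \<and> v \<in> qls_entries 6 \<Phi>\<^sub>3\<^sub>2 \<and> phase_equiv u v} =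
      {(u, v). u \<in> qls_entries 6 \<Phi>\<^sub>3\<^sub>2 \<and> v \<in> qls_entries 6 \<Phi>\<^sub>3\<^sub>2 \<and> u = v}"
    unfolding qls_entries_def using phase_equiv_Phi_iff by blast
  then show "qls_cardinality 6 \<Phi>\<^sub>3\<^sub>2 = 32"
    unfolding qls_cardinality_def by (simp only: card_quotient_identity card)
qed

end
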